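(* Let $(M,g)$ be a complete Riemannian manifold of dimension $d$ such that $TM$ is parallelizable, let $\kappa\in\mathbb{N}$, and let $V:\mathbb{R}^d\to\Gamma(TM)$ be a dynamical system such that $g(V_a(m),V_b(m))=a\cdot b$ for all $a,b\in\mathbb{R}^d$ and $m\in M$. Let $Q(a,b)\in C^\infty(M,\mathbb{R}^d)$ be determined by $[V_a,V_b]=V_{Q(a,b)}$ for all $a,b\in\mathbb{R}^d$. If $V_{a_1}\cdots V_{a_k}Q(a,b)\in C^\infty(M,\mathbb{R}^d)$ is bounded for all $0\le k\le\kappa-1$, all $a,b\in\mathbb{R}^d$ and all $a_1,\dots,a_k\in\mathbb{R}^d$, then $$|V^{(\kappa)}|_M+|\nabla V^{(\kappa)}|_M<\infty .$$
   Context: A dynamical system is a linear map $a\mapsto V_a$ from $\mathbb{R}^d$ to the smooth vector fields $\Gamma(TM)$. For $f\in C^\infty(M,\mathbb{R}^d)$, $V_f\in\Gamma(TM)$ is the vector field $V_f(m):=V_{f(m)}(m)$. $V_{a_1}\cdots V_{a_k}Q(a,b)$ denotes iterated directional derivatives ($k=0$ meaning $Q(a,b)$ itself). $F^{(\kappa)}(\mathbb{R}^d)$ is the Lie subalgebra generated by $\mathbb{R}^d$ in the truncated tensor algebra $\oplus_{k=0}^{\kappa}(\mathbb{R}^d)^{\otimes k}$ (tensor product with degree $>\kappa$ terms dropped, bracket $[A,B]=AB-BA$), with the norm $|\cdot|$ induced from the dot product (different degrees orthogonal). $V^{(\kappa)}:F^{(\kappa)}(\mathbb{R}^d)\to\Gamma(TM)$,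 $A\mapsto V_A$, is the unique linear map with $V_A=L_{V_{w_1}}\cdots L_{V_{w_{j-1}}}V_{w_j}$ (iterated Lie brackets) whenever $A=\mathrm{ad}_{w_1}\cdots\mathrm{ad}_{w_{j-1}}w_j$, $1\le j\le\kappa$, $w_i\in\mathbb{R}^d$. With $\nabla$ the Levi-Civita derivative of $g$: $|V^{(\kappa)}|_M=\sup\{\sup_m|V_A(m)|_g:|A|=1\}$ and $|\nabla V^{(\kappa)}|_M=\sup\{\sup_{v\in TM,|v|=1}|\nabla_vV_A|_g:|A|=1\}$, $A$ ranging over $F^{(\kappa)}(\mathbb{R}^d)$. *)

theory Defs
  imports "HOL-Analysis.Analysis"
begin

section \<open>Smooth maps between open subsets of normed spaces\<close>

fun Ck_on :: "nat \<Rightarrow> 'a::real_normed_vector set \<Rightarrow> ('a \<Rightarrow> 'b::real_normed_vector) \<Rightarrow> bool" where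
  "Ck_on 0 S f \<longleftrightarrow> continuous_on S f"
| "Ck_on (Suc n) S f \<longleftrightarrow>
     (\<forall>x\<in>S. f differentiable (at x)) \<and> (\<forall>v. Ck_on n S (\<lambda>x. frechet_derivative f (at x) v))"

definition smooth_on :: "'a::real_normed_vector set \<Rightarrow> ('a \<Rightarrow> 'b::real_normed_vector) \<Rightarrow> bool" where
  "smooth_on S f \<longleftrightarrow> (\<forall>n. Ck_on n S f)"

section \<open>Manifolds and tangent vectors\<close>

text \<open>The points of the manifold are all elements of a Hausdorff, second countable type; the smooth
  structure is given by an atlas that need not be maximal. The dimension is \<open>CARD('d)\<close>.\<close>

type_synonym ('m, 'd) chart = "'m set \<times> ('m \<Rightarrow> real ^ 'd)"

definition smooth_atlas ::
  "('m::{t2_space, second_countable_topology}, 'd::finite) chart set \<Rightarrow> bool" where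
  "smooth_atlas \<A> \<longleftrightarrow>
     (\<Union>(U, \<phi>)\<in>\<A>. U) = UNIV \<and>
     (\<forall>(U, \<phi>)\<in>\<A>. open U \<and> open (\<phi> ` U) \<and> homeomorphism U (\<phi> ` U) \<phi> (inv_into U \<phi>)) \<and>
     (\<forall>(U, \<phi>)\<in>\<A>. \<forall>(W, \<psi>)\<in>\<A>. smooth_on (\<phi> ` (U \<inter> W)) (\<psi> \<circ> inv_into U \<phi>))"

definition smooth_map ::
  "('m, 'd::finite) chart set \<Rightarrow> ('m \<Rightarrow> 'b::real_normed_vector) \<Rightarrow> bool" where
  "smooth_map \<A> f \<longleftrightarrow> (\<forall>(U, \<phi>)\<in>\<A>. smooth_on (\<phi> ` U) (f \<circ> inv_into U \<phi>))"

text \<open>A tangent vector is the operator of directional differentiation (in some chart) that it induces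
  on smooth real functions. It takes the value 0 on functions that are not smooth, so that equality
  of tangent vectors is equality in HOL.\<close>

type_synonym 'm tvec = "('m \<Rightarrow> real) \<Rightarrow> real"
type_synonym 'm vfield = "'m \<Rightarrow> 'm tvec"

definition tangent_space :: "('m, 'd::finite) chart set \<Rightarrow> 'm \<Rightarrow> 'm tvec set" where
  "tangent_space \<A> m =
     {v. \<exists>(U, \<phi>)\<in>\<A>. m \<in> U \<and>
        (\<exists>u. v = (\<lambda>f. if smooth_map \<A> f
                     then frechet_derivative (f \<circ> inv_into U \<phi>) (at (\<phi> m)) u else 0))}"

definition vector_fields :: "('m, 'd::finite) chart set \<Rightarrow> 'm vfield set" where
  "vector_fields \<A> =
     {X. (\<forall>m. X m \<in> tangent_space \<A> m) \<and>
         (\<forall>f. smooth_map \<A> f \<longrightarrow> smooth_map \<A> (\<lambda>m. X m f))}"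

definition lie_bracket :: "'m vfield \<Rightarrow> 'm vfield \<Rightarrow> 'm vfield" where
  "lie_bracket X Y = (\<lambda>m f. X m (\<lambda>p. Y p f) - Y m (\<lambda>p. X p f))"

definition parallelizable :: "('m, 'd::finite) chart set \<Rightarrow> bool" where
  "parallelizable \<A> \<longleftrightarrow>
     (\<exists>E :: 'd \<Rightarrow> 'm vfield.
        (\<forall>i. E i \<in> vector_fields \<A>) \<and>
        (\<forall>m. \<forall>v\<in>tangent_space \<A> m. \<exists>!c :: real ^ 'd. v = (\<lambda>f. \<Sum>i\<in>UNIV. c $ i * E i m f)))"

section \<open>Riemannian metrics\<close>

definition riemannian_metric ::
  "('m, 'd::finite) chart set \<Rightarrow> ('m \<Rightarrow> 'm tvec \<Rightarrow> 'm tvec \<Rightarrow> real) \<Rightarrow> bool" where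
  "riemannian_metric \<A> g \<longleftrightarrow>
     (\<forall>m. \<forall>u\<in>tangent_space \<A> m. \<forall>v\<in>tangent_space \<A> m. g m u v = g m v u) \<and>
     (\<forall>m. \<forall>u\<in>tangent_space \<A> m. \<forall>v\<in>tangent_space \<A> m. \<forall>w\<in>tangent_space \<A> m. \<forall>b c.
        g m (\<lambda>f. b * u f + c * v f) w = b * g m u w + c * g m v w) \<and>
     (\<forall>m. \<forall>v\<in>tangent_space \<A> m. v \<noteq> (\<lambda>f. 0) \<longrightarrow> g m v v > 0) \<and>
     (\<forall>X\<in>vector_fields \<A>. \<forall>Y\<in>vector_fields \<A>. smooth_map \<A> (\<lambda>m. g m (X m) (Y m)))"

definition gnorm :: "('m \<Rightarrow> 'm tvec \<Rightarrow> 'm tvec \<Rightarrow> real) \<Rightarrow> 'm \<Rightarrow> 'm tvec \<Rightarrow> real" where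
  "gnorm g m v = sqrt (g m v v)"

definition velocity :: "('m, 'd::finite) chart set \<Rightarrow> (real \<Rightarrow> 'm) \<Rightarrow> real \<Rightarrow> 'm tvec" where
  "velocity \<A> \<gamma> t =
     (\<lambda>f. if smooth_map \<A> f then vector_derivative (f \<circ> \<gamma>) (at t) else 0)"

definition piecewise_C1_curve ::
  "('m::topological_space, 'd::finite) chart set \<Rightarrow> (real \<Rightarrow> 'm) \<Rightarrow> bool" where
  "piecewise_C1_curve \<A> \<gamma> \<longleftrightarrow>
     continuous_on {0..1} \<gamma> \<and>
     (\<exists>S. finite S \<and> (\<forall>f::'m \<Rightarrow> real. smooth_map \<A> f \<longrightarrow> (f \<circ> \<gamma>) C1_differentiable_on ({0..1} - S)))"

definition curve_length ::
  "('m, 'd::finite) chart set \<Rightarrow> ('m \<Rightarrow> 'm tvec \<Rightarrow> 'm tvec \<Rightarrow> real) \<Rightarrow> (real \<Rightarrow> 'm) \<Rightarrow> ennreal" where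
  "curve_length \<A> g \<gamma> = (\<integral>\<^sup>+ t\<in>{0..1}. ennreal (gnorm g (\<gamma> t) (velocity \<A> \<gamma> t)) \<partial>lborel)"

text \<open>The Riemannian distance is \<open>\<infinity>\<close> between different connected components.\<close>

definition riemannian_dist ::
  "('m::topological_space, 'd::finite) chart set \<Rightarrow> ('m \<Rightarrow> 'm tvec \<Rightarrow> 'm tvec \<Rightarrow> real)
     \<Rightarrow> 'm \<Rightarrow> 'm \<Rightarrow> ennreal" where
  "riemannian_dist \<A> g p q =
     (INF \<gamma>\<in>{\<gamma>. piecewise_C1_curve \<A> \<gamma> \<and> \<gamma> 0 = p \<and> \<gamma> 1 = q}. curve_length \<A> g \<gamma>)"

definition complete_riemannian ::
  "('m::topological_space, 'd::finite) chart set \<Rightarrow> ('m \<Rightarrow> 'm tvec \<Rightarrow> 'm tvec \<Rightarrow> real) \<Rightarrow> bool" where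
  "complete_riemannian \<A> g \<longleftrightarrow>
     (\<forall>x :: nat \<Rightarrow> 'm.
        (\<forall>e>0. \<exists>N. \<forall>i\<ge>N. \<forall>j\<ge>N. riemannian_dist \<A> g (x i) (x j) < ennreal e) \<longrightarrow>
        (\<exists>l. (\<lambda>n. riemannian_dist \<A> g (x n) l) \<longlonglongrightarrow> 0))"

text \<open>\<open>nabla m v Y\<close> is the covariant derivative at \<open>m\<close> of the field \<open>Y\<close> in the direction
  of the tangent vector \<open>v\<close> at \<open>m\<close>.\<close>

definition levi_civita ::
  "('m, 'd::finite) chart set \<Rightarrow> ('m \<Rightarrow> 'm tvec \<Rightarrow> 'm tvec \<Rightarrow> real)
     \<Rightarrow> ('m \<Rightarrow> 'm tvec \<Rightarrow> 'm vfield \<Rightarrow> 'm tvec) \<Rightarrow> bool" where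
  "levi_civita \<A> g nabla \<longleftrightarrow>
     \<comment> \<open>affine connection\<close>
     (\<forall>Y\<in>vector_fields \<A>. \<forall>m. \<forall>v\<in>tangent_space \<A> m. nabla m v Y \<in> tangent_space \<A> m) \<and>
     (\<forall>X\<in>vector_fields \<A>. \<forall>Y\<in>vector_fields \<A>. (\<lambda>m. nabla m (X m) Y) \<in> vector_fields \<A>) \<and>
     (\<forall>Y\<in>vector_fields \<A>. \<forall>m. \<forall>u\<in>tangent_space \<A> m. \<forall>v\<in>tangent_space \<A> m. \<forall>b c.
        nabla m (\<lambda>f. b * u f + c * v f) Y = (\<lambda>f. b * nabla m u Y f + c * nabla m v Y f)) \<and>
     (\<forall>Y\<in>vector_fields \<A>. \<forall>Z\<in>vector_fields \<A>. \<forall>m. \<forall>v\<in>tangent_space \<A> m.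
        nabla m v (\<lambda>p f. Y p f + Z p f) = (\<lambda>f. nabla m v Y f + nabla m v Z f)) \<and>
     (\<forall>Y\<in>vector_fields \<A>. \<forall>h. smooth_map \<A> h \<longrightarrow> (\<forall>m. \<forall>v\<in>tangent_space \<A> m.
        nabla m v (\<lambda>p f. h p * Y p f) = (\<lambda>f. v h * Y m f + h m * nabla m v Y f))) \<and>
     \<comment> \<open>vanishing torsion\<close>
     (\<forall>X\<in>vector_fields \<A>. \<forall>Y\<in>vector_fields \<A>. \<forall>m.
        (\<lambda>f. nabla m (X m) Y f - nabla m (Y m) X f) = lie_bracket X Y m) \<and>
     \<comment> \<open>metric compatibility\<close>
     (\<forall>Y\<in>vector_fields \<A>. \<forall>Z\<in>vector_fields \<A>. \<forall>m. \<forall>v\<in>tangent_space \<A> m.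
        v (\<lambda>p. g p (Y p) (Z p)) = g m (nabla m v Y) (Z m) + g m (Y m) (nabla m v Z))"

section \<open>Dynamical systems\<close>

definition dynamical_system ::
  "('m, 'd::finite) chart set \<Rightarrow> (real ^ 'd \<Rightarrow> 'm vfield) \<Rightarrow> bool" where
  "dynamical_system \<A> V \<longleftrightarrow>
     (\<forall>a. V a \<in> vector_fields \<A>) \<and>
     (\<forall>a b. V (a + b) = (\<lambda>m f. V a m f + V b m f)) \<and>
     (\<forall>c a. V (c *\<^sub>R a) = (\<lambda>m f. c * V a m f))"

definition fun_field :: "(real ^ 'd \<Rightarrow> 'm vfield) \<Rightarrow> ('m \<Rightarrow> real ^ 'd) \<Rightarrow> 'm vfield" where
  "fun_field V F = (\<lambda>m. V (F m) m)"

definition dir_deriv :: "'m vfield \<Rightarrow> ('m \<Rightarrow> real ^ 'd) \<Rightarrow> ('m \<Rightarrow> real ^ 'd)" where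
  "dir_deriv X F = (\<lambda>m. \<chi> i. X m (\<lambda>p. F p $ i))"

definition iter_deriv ::
  "(real ^ 'd \<Rightarrow> 'm vfield) \<Rightarrow> (real ^ 'd) list \<Rightarrow> ('m \<Rightarrow> real ^ 'd) \<Rightarrow> ('m \<Rightarrow> real ^ 'd)" where
  "iter_deriv V as F = foldr (\<lambda>a. dir_deriv (V a)) as F"

section \<open>The free nilpotent Lie algebra in the truncated tensor algebra\<close>

text \<open>A tensor is given by its coefficients: the value at the word \<open>[i\<^sub>1, \<dots>, i\<^sub>k]\<close> is the coefficient
  of the product of the standard basis vectors with these indices. In the algebra truncated at degree
  \<open>\<kappa>\<close> the coefficients of all words longer than \<open>\<kappa>\<close> are 0.\<close>

type_synonym 'd tensor = "'d list \<Rightarrow> real"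

definition tmult :: "nat \<Rightarrow> 'd tensor \<Rightarrow> 'd tensor \<Rightarrow> 'd tensor" where
  "tmult \<kappa> S T =
     (\<lambda>w. if length w \<le> \<kappa> then \<Sum>i\<le>length w. S (take i w) * T (drop i w) else 0)"

definition tbracket :: "nat \<Rightarrow> 'd tensor \<Rightarrow> 'd tensor \<Rightarrow> 'd tensor" where
  "tbracket \<kappa> S T = (\<lambda>w. tmult \<kappa> S T w - tmult \<kappa> T S w)"

definition tvector :: "nat \<Rightarrow> real ^ 'd \<Rightarrow> 'd tensor" where
  "tvector \<kappa> a = (\<lambda>w. case w of [i] \<Rightarrow> if 1 \<le> \<kappa> then a $ i else 0 | _ \<Rightarrow> 0)"

definition tnorm :: "nat \<Rightarrow> 'd::finite tensor \<Rightarrow> real" where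
  "tnorm \<kappa> T = sqrt (\<Sum>w\<in>{w. length w \<le> \<kappa>}. (T w)\<^sup>2)"

inductive_set free_nilpotent :: "nat \<Rightarrow> 'd::finite tensor set" for \<kappa> :: nat where
  vector: "tvector \<kappa> a \<in> free_nilpotent \<kappa>"
| add: "S \<in> free_nilpotent \<kappa> \<Longrightarrow> T \<in> free_nilpotent \<kappa> \<Longrightarrow> (\<lambda>w. S w + T w) \<in> free_nilpotent \<kappa>"
| scale: "T \<in> free_nilpotent \<kappa> \<Longrightarrow> (\<lambda>w. c * T w) \<in> free_nilpotent \<kappa>"
| bracket: "S \<in> free_nilpotent \<kappa> \<Longrightarrow> T \<in> free_nilpotent \<kappa> \<Longrightarrow> tbracket \<kappa> S T \<in> free_nilpotent \<kappa>"

text \<open>\<open>VK\<close> is the linear extension of \<open>V\<close> to \<open>free_nilpotent \<kappa>\<close>. In the last clause \<open>ws @ [w]\<close>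
  is the sequence of the \<open>j = length ws + 1\<close> vectors that occur in the iterated brackets. The clauses
  determine \<open>VK\<close> on \<open>free_nilpotent \<kappa>\<close>; its values elsewhere are irrelevant.\<close>

definition lie_extension ::
  "('m, 'd::finite) chart set \<Rightarrow> nat \<Rightarrow> (real ^ 'd \<Rightarrow> 'm vfield) \<Rightarrow> ('d tensor \<Rightarrow> 'm vfield) \<Rightarrow> bool" where
  "lie_extension \<A> \<kappa> V VK \<longleftrightarrow>
     (\<forall>T\<in>free_nilpotent \<kappa>. VK T \<in> vector_fields \<A>) \<and>
     (\<forall>S\<in>free_nilpotent \<kappa>. \<forall>T\<in>free_nilpotent \<kappa>.
        VK (\<lambda>w. S w + T w) = (\<lambda>m f. VK S m f + VK T m f)) \<and>
     (\<forall>T\<in>free_nilpotent \<kappa>. \<forall>c. VK (\<lambda>w. c * T w) = (\<lambda>m f. c * VK T m f)) \<and>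
     (\<forall>ws w. length ws < \<kappa> \<longrightarrow>
        VK (foldr (\<lambda>a T. tbracket \<kappa> (tvector \<kappa> a) T) ws (tvector \<kappa> w))
          = foldr (\<lambda>a X. lie_bracket (V a) X) ws (V w))"

text \<open>The two norms below are suprema in \<open>ennreal\<close>, so that they exist without a
  boundedness assumption.\<close>

definition field_norm ::
  "('m \<Rightarrow> 'm tvec \<Rightarrow> 'm tvec \<Rightarrow> real) \<Rightarrow> nat \<Rightarrow> ('d::finite tensor \<Rightarrow> 'm vfield) \<Rightarrow> ennreal" where
  "field_norm g \<kappa> VK =
     (SUP T\<in>{T \<in> free_nilpotent \<kappa>. tnorm \<kappa> T = 1}. SUP m. ennreal (gnorm g m (VK T m)))"

definition covariant_norm ::
  "('m, 'd::finite) chart set \<Rightarrow> ('m \<Rightarrow> 'm tvec \<Rightarrow> 'm tvec \<Rightarrow> real)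
     \<Rightarrow> ('m \<Rightarrow> 'm tvec \<Rightarrow> 'm vfield \<Rightarrow> 'm tvec) \<Rightarrow> nat \<Rightarrow> ('d tensor \<Rightarrow> 'm vfield) \<Rightarrow> ennreal" where
  "covariant_norm \<A> g nabla \<kappa> VK =
     (SUP T\<in>{T \<in> free_nilpotent \<kappa>. tnorm \<kappa> T = 1}.
        SUP (m, v)\<in>{(m, v). v \<in> tangent_space \<A> m \<and> gnorm g m v = 1}.
          ennreal (gnorm g m (nabla m v (VK T))))"

end

theory Submission
  imports Defs
begin

text \<open>
  The point is that both norms can be read off from coefficient functions. At every point \<open>m\<close> the
  map \<open>a \<mapsto> V a m\<close> is a linear isometry of \<open>\<real>\<^sup>d\<close> onto the tangent space (\<open>tangent_space_eq\<close>), so a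
  vector field is \<open>V\<^sub>F\<close> for a function \<open>F\<close> with values in \<open>\<real>\<^sup>d\<close>, and its pointwise norm is that of \<open>F\<close>.

  By the Leibniz rule \<open>[V\<^sub>a, V\<^sub>F]\<close> has the coefficient \<open>\<Sum>\<^sub>i F\<^sub>i Q(a, e\<^sub>i) + V\<^sub>a F\<close>. A bracket with \<open>V\<^sub>a\<close>
  therefore costs one derivative: if \<open>F\<close> has bounded iterated derivatives up to order \<open>n + 1\<close>, with
  \<open>n < \<kappa>\<close>, then the new coefficient has them up to order \<open>n\<close>, by the assumption on \<open>Q\<close>. Starting from
  a constant, \<open>j - 1 < \<kappa>\<close> brackets leave bounded derivatives up to order \<open>\<kappa> - (j - 1) \<ge> 1\<close>
  (\<open>nested_bracket_coeff\<close>). The bound of order 0 controls \<open>V\<^sub>F\<close>. The bound of order 1 controls \<open>\<nabla>V\<^sub>F\<close>,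
  because in the formula \<open>\<nabla>\<^sub>v V\<^sub>F = \<Sum>\<^sub>i (v F\<^sub>i) V\<^bsub>e\<^sub>i\<^esub> + F\<^sub>i \<nabla>\<^sub>v V\<^bsub>e\<^sub>i\<^esub>\<close> the Koszul formula expresses the
  connection coefficients of an orthonormal frame by \<open>Q\<close> alone (\<open>christoffel_koszul\<close>,
  \<open>bounded_nabla_fun_field\<close>).

  By the Jacobi identity the right-nested brackets of vectors span the free nilpotent Lie algebra
  (\<open>free_nilpotent_nested_span\<close>), and those of more than \<open>\<kappa>\<close> vectors vanish. Hence \<open>V\<^sub>A\<close> and \<open>\<nabla>V\<^sub>A\<close> are
  bounded for each single \<open>A\<close>. As \<open>A\<close> ranges over a finite-dimensional space, the bound is uniform for
  \<open>|A| = 1\<close> (\<open>uniform_boundedness_finite_support\<close>).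
\<close>

section \<open>Smooth functions and derivations\<close>

text \<open>Openness of \<open>S\<close> matters: the derivatives are taken in the ambient space.\<close>

lemma Ck_on_cong:
  assumes "open S" "\<And>x. x \<in> S \<Longrightarrow> f x = h x" "Ck_on n S f"
  shows "Ck_on n S h"
  using assms(2,3)
proof (induction n arbitrary: f h)
  case 0
  then show ?case by (simp cong: continuous_on_cong)
next
  case (Suc n)
  have hd: "(h has_derivative frechet_derivative f (at x)) (at x)" if "x \<in> S" for x
  proof (rule has_derivative_transform_within_open[OF _ assms(1) that Suc.prems(1)])
    show "(f has_derivative frechet_derivative f (at x)) (at x)"
      using Suc.prems(2) that by (simp add: frechet_derivative_works)
  qed
  then have eq: "frechet_derivative h (at x) = frechet_derivative f (at x)" if "x \<in> S" for x
    using frechet_derivative_at[OF hd[OF that]] by simp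
  have "Ck_on n S (\<lambda>x. frechet_derivative h (at x) v)" for v
  proof (rule Suc.IH)
    show "Ck_on n S (\<lambda>x. frechet_derivative f (at x) v)"
      using Suc.prems(2) by simp
  qed (simp add: eq)
  then show ?case using hd unfolding Ck_on.simps differentiable_def by blast
qed

lemma Ck_on_SucD: "Ck_on (Suc n) S f \<Longrightarrow> Ck_on n S f"
proof (induction n arbitrary: f)
  case 0
  then show ?case
    by (auto intro!: continuous_at_imp_continuous_on differentiable_imp_continuous_within)
next
  case (Suc n)
  then show ?case unfolding Ck_on.simps(2)[of "Suc n"] Ck_on.simps(2)[of n] by blast
qed

lemma Ck_on_const: "Ck_on n S (\<lambda>x. c)"
  by (induction n arbitrary: c) simp_all

lemma Ck_on_bounded_linear:
  assumes "open S" "bounded_linear l" "Ck_on n S f"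
  shows "Ck_on n S (\<lambda>x. l (f x))"
  using assms(3)
proof (induction n arbitrary: f)
  case 0
  then show ?case using assms(2) by (simp add: bounded_linear.continuous_on)
next
  case (Suc n)
  have hd: "((\<lambda>x. l (f x)) has_derivative (\<lambda>v. l (frechet_derivative f (at x) v))) (at x)"
    if "x \<in> S" for x
    using Suc.prems that frechet_derivative_works bounded_linear.has_derivative[OF assms(2)]
    by fastforce
  have "Ck_on n S (\<lambda>x. frechet_derivative (\<lambda>x. l (f x)) (at x) v)" for v
  proof (rule Ck_on_cong[OF assms(1)])
    show "Ck_on n S (\<lambda>x. l (frechet_derivative f (at x) v))"
      using Suc.prems by (intro Suc.IH) simp
  qed (simp add: frechet_derivative_at[OF hd, symmetric])
  then show ?case using hd unfolding Ck_on.simps differentiable_def by blast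
qed

lemma Ck_on_add:
  assumes "open S" "Ck_on n S f" "Ck_on n S h"
  shows "Ck_on n S (\<lambda>x. f x + h x)"
  using assms(2,3)
proof (induction n arbitrary: f h)
  case 0
  then show ?case by (simp add: continuous_on_add)
next
  case (Suc n)
  have hd: "((\<lambda>x. f x + h x) has_derivative
      (\<lambda>v. frechet_derivative f (at x) v + frechet_derivative h (at x) v)) (at x)"
    if "x \<in> S" for x
    using Suc.prems that by (auto intro!: has_derivative_add simp: frechet_derivative_works)
  have "Ck_on n S (\<lambda>x. frechet_derivative (\<lambda>x. f x + h x) (at x) v)" for v
  proof (rule Ck_on_cong[OF assms(1)])
    show "Ck_on n S (\<lambda>x. frechet_derivative f (at x) v + frechet_derivative h (at x) v)"
      using Suc.prems by (intro Suc.IH) simp_all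
  qed (simp add: frechet_derivative_at[OF hd, symmetric])
  then show ?case using hd unfolding Ck_on.simps differentiable_def by blast
qed

lemma Ck_on_mult:
  fixes f h :: "'a::real_normed_vector \<Rightarrow> real"
  assumes "open S" "Ck_on n S f" "Ck_on n S h"
  shows "Ck_on n S (\<lambda>x. f x * h x)"
  using assms(2,3)
proof (induction n arbitrary: f h)
  case 0
  then show ?case by (simp add: continuous_on_mult)
next
  case (Suc n)
  have hd: "((\<lambda>x. f x * h x) has_derivative
      (\<lambda>v. f x * frechet_derivative h (at x) v + frechet_derivative f (at x) v * h x)) (at x)"
    if "x \<in> S" for x
    using Suc.prems that by (auto intro!: has_derivative_mult simp: frechet_derivative_works)
  have low: "Ck_on n S f" "Ck_on n S h"
    using Suc.prems Ck_on_SucD by blast+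
  have "Ck_on n S (\<lambda>x. f x * frechet_derivative h (at x) v + frechet_derivative f (at x) v * h x)" for v
    using Suc.prems low by (intro Ck_on_add[OF assms(1)] Suc.IH) auto
  then have "Ck_on n S (\<lambda>x. frechet_derivative (\<lambda>x. f x * h x) (at x) v)" for v
    by (rule Ck_on_cong[OF assms(1), rotated]) (simp add: frechet_derivative_at[OF hd, symmetric])
  then show ?case using hd unfolding Ck_on.simps differentiable_def by blast
qed

lemma smooth_map_const: "smooth_map \<A> (\<lambda>m. c)"
  unfolding smooth_map_def smooth_on_def o_def using Ck_on_const by blast

lemma smooth_map_compose2:
  fixes \<A> :: "('m::{t2_space, second_countable_topology}, 'd::finite) chart set"
  assumes "smooth_atlas \<A>" "smooth_map \<A> f" "smooth_map \<A> h"
    and "\<And>(S :: (real ^ 'd) set) n k l. open S \<Longrightarrow> Ck_on n S k \<Longrightarrow> Ck_on n S l \<Longrightarrow> Ck_on n S (\<lambda>x. F (k x) (l x))"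
  shows "smooth_map \<A> (\<lambda>m. F (f m) (h m))"
  unfolding smooth_map_def smooth_on_def
proof safe
  fix U \<phi> n assume U: "(U, \<phi>) \<in> \<A>"
  then have "open (\<phi> ` U)"
    using assms(1) unfolding smooth_atlas_def by blast
  moreover have "Ck_on n (\<phi> ` U) (f \<circ> inv_into U \<phi>)" "Ck_on n (\<phi> ` U) (h \<circ> inv_into U \<phi>)"
    using assms(2,3) U unfolding smooth_map_def smooth_on_def by blast+
  ultimately show "Ck_on n (\<phi> ` U) ((\<lambda>m. F (f m) (h m)) \<circ> inv_into U \<phi>)"
    using assms(4) by (simp add: o_def)
qed

lemma smooth_map_add:
  assumes "smooth_atlas \<A>" "smooth_map \<A> f" "smooth_map \<A> h"
  shows "smooth_map \<A> (\<lambda>m. f m + h m)"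
  by (rule smooth_map_compose2[OF assms Ck_on_add])

lemma smooth_map_mult:
  fixes f h :: "'m::{t2_space, second_countable_topology} \<Rightarrow> real"
  assumes "smooth_atlas \<A>" "smooth_map \<A> f" "smooth_map \<A> h"
  shows "smooth_map \<A> (\<lambda>m. f m * h m)"
  by (rule smooth_map_compose2[OF assms Ck_on_mult])

lemma smooth_map_component:
  assumes "smooth_atlas \<A>" "smooth_map \<A> F"
  shows "smooth_map \<A> (\<lambda>m. F m $ i)"
  by (rule smooth_map_compose2[OF assms assms(2), of "\<lambda>x y. x $ i"])
    (rule Ck_on_bounded_linear[OF _ bounded_linear_vec_nth])

lemma smooth_map_sum:
  assumes "smooth_atlas \<A>" "finite I" "\<And>i. i \<in> I \<Longrightarrow> smooth_map \<A> (f i)"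
  shows "smooth_map \<A> (\<lambda>m. \<Sum>i\<in>I. f i m)"
  using assms(2,3)
  by (induction I rule: finite_induct) (simp_all add: smooth_map_const smooth_map_add[OF assms(1)])

text \<open>In the chart that represents it a tangent vector is a directional derivative, so it
  inherits the rules of differentiation.\<close>

lemma tangent_vector_derivation:
  assumes "smooth_atlas \<A>" "v \<in> tangent_space \<A> m"
  shows tangent_vector_add:
      "smooth_map \<A> f \<Longrightarrow> smooth_map \<A> h \<Longrightarrow> v (\<lambda>p. f p + h p) = v f + v h"
    and tangent_vector_mult:
      "smooth_map \<A> f \<Longrightarrow> smooth_map \<A> h \<Longrightarrow> v (\<lambda>p. f p * h p) = f m * v h + v f * h m"
    and tangent_vector_const: "v (\<lambda>p. c) = 0"
proof -
  obtain U \<phi> u where U: "(U, \<phi>) \<in> \<A>" "m \<in> U"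
    and v: "v = (\<lambda>f. if smooth_map \<A> f
        then frechet_derivative (f \<circ> inv_into U \<phi>) (at (\<phi> m)) u else 0)"
    using assms(2) by (auto simp: tangent_space_def)
  have inv: "inv_into U \<phi> (\<phi> m) = m"
    using assms(1) U by (auto simp: smooth_atlas_def homeomorphism_def)
  have der: "(f \<circ> inv_into U \<phi> has_derivative
      frechet_derivative (f \<circ> inv_into U \<phi>) (at (\<phi> m))) (at (\<phi> m))"
    if "smooth_map \<A> f" for f
  proof -
    have "Ck_on (Suc 0) (\<phi> ` U) (f \<circ> inv_into U \<phi>)"
      using that U unfolding smooth_map_def smooth_on_def by blast
    then show ?thesis using U by (auto simp: frechet_derivative_works)
  qed
  show "v (\<lambda>p. f p + h p) = v f + v h" if "smooth_map \<A> f" "smooth_map \<A> h"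
    using frechet_derivative_at[OF has_derivative_add[OF der[OF that(1)] der[OF that(2)]], symmetric]
      smooth_map_add[OF assms(1) that] that by (simp add: v o_def)
  show "v (\<lambda>p. f p * h p) = f m * v h + v f * h m" if "smooth_map \<A> f" "smooth_map \<A> h"
    using frechet_derivative_at[OF has_derivative_mult[OF der[OF that(1)] der[OF that(2)]], symmetric]
      smooth_map_mult[OF assms(1) that] that by (simp add: v o_def inv)
  show "v (\<lambda>p. c) = 0"
    by (simp add: v o_def smooth_map_const frechet_derivative_const)
qed

lemma tangent_vector_sum:
  assumes "smooth_atlas \<A>" "v \<in> tangent_space \<A> m" "finite I"
    and "\<And>i. i \<in> I \<Longrightarrow> smooth_map \<A> (f i)"
  shows "v (\<lambda>p. \<Sum>i\<in>I. f i p) = (\<Sum>i\<in>I. v (f i))"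
  using assms(3,4)
  by (induction I rule: finite_induct)
    (simp_all add: tangent_vector_const[OF assms(1,2)] tangent_vector_add[OF assms(1,2)]
      smooth_map_sum[OF assms(1)])

lemma vector_field_tangent: "X \<in> vector_fields \<A> \<Longrightarrow> X m \<in> tangent_space \<A> m"
  by (simp add: vector_fields_def)

text \<open>If \<open>f\<close> is not smooth, then \<open>m \<mapsto> X m f\<close> is the zero function. Iterated derivatives can thus be
  treated without distinguishing whether the innermost function is smooth.\<close>

lemma smooth_map_vector_field:
  assumes "X \<in> vector_fields \<A>"
  shows "smooth_map \<A> (\<lambda>m. X m f)"
proof (cases "smooth_map \<A> f")
  case True
  then show ?thesis using assms by (simp add: vector_fields_def)
next
  case False
  have "X m f = 0" for m
    using vector_field_tangent[OF assms, of m] False by (auto simp: tangent_space_def)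
  then show ?thesis by (simp add: smooth_map_const)
qed

section \<open>Functions with bounded iterated derivatives\<close>

fun bounded_derivs :: "(real ^ 'd::finite \<Rightarrow> 'm vfield) \<Rightarrow> nat \<Rightarrow> ('m \<Rightarrow> real) \<Rightarrow> bool" where
  "bounded_derivs V 0 h \<longleftrightarrow> bounded (range h)"
| "bounded_derivs V (Suc n) h \<longleftrightarrow>
     bounded (range h) \<and> (\<forall>a. bounded_derivs V n (\<lambda>m. V a m h))"

lemma bounded_derivs_SucD: "bounded_derivs V (Suc n) h \<Longrightarrow> bounded_derivs V n h"
proof (induction n arbitrary: h)
  case (Suc n)
  then show ?case
    unfolding bounded_derivs.simps(2)[of V "Suc n"] bounded_derivs.simps(2)[of V n] by blast
qed simp

lemma bounded_derivs_mono: "bounded_derivs V n h \<Longrightarrow> k \<le> n \<Longrightarrow> bounded_derivs V k h"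
proof (induction n)
  case (Suc n)
  then show ?case
    using bounded_derivs_SucD[of V n h] by (cases "k = Suc n") (simp_all add: le_Suc_eq)
qed simp

text \<open>The recursion of \<^const>\<open>bounded_derivs\<close> removes the innermost derivative, which is the last
  element of the list, whereas \<^const>\<open>foldr\<close> applies the first element last.\<close>

lemma bounded_derivs_iterate:
  fixes V :: "real ^ 'd::finite \<Rightarrow> 'm vfield"
  assumes "\<And>as. length as \<le> n \<Longrightarrow> bounded (range (foldr (\<lambda>a h m. V a m h) as h))"
  shows "bounded_derivs V n h"
  using assms
proof (induction n arbitrary: h)
  case 0
  from 0[of "[]"] show ?case by simp
next
  case (Suc n)
  have "bounded_derivs V n (\<lambda>m. V a m h)" for a
  proof (rule Suc.IH)
    fix as :: "(real ^ 'd) list" assume "length as \<le> n"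
    then show "bounded (range (foldr (\<lambda>a h m. V a m h) as (\<lambda>m. V a m h)))"
      using Suc.prems[of "as @ [a]"] by simp
  qed
  then show ?case using Suc.prems[of "[]"] by simp
qed

lemma iter_deriv_component:
  "iter_deriv V as F m $ i = foldr (\<lambda>a h p. V a p h) as (\<lambda>p. F p $ i) m"
proof (induction as arbitrary: m)
  case Nil
  then show ?case by (simp add: iter_deriv_def)
next
  case (Cons a as)
  have "iter_deriv V (a # as) F m $ i = V a m (\<lambda>p. iter_deriv V as F p $ i)"
    by (simp add: iter_deriv_def dir_deriv_def)
  then show ?case using Cons by simp
qed

lemma bounded_range_component:
  fixes F :: "'m \<Rightarrow> real ^ 'd::finite"
  shows "bounded (range F) \<Longrightarrow> bounded (range (\<lambda>m. F m $ i))"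
  unfolding bounded_iff by (auto intro: order_trans[OF component_le_norm_cart])

lemma bounded_derivs_component:
  fixes V :: "real ^ 'd::finite \<Rightarrow> 'm vfield"
  assumes "\<And>as. length as \<le> n \<Longrightarrow> bounded (range (iter_deriv V as F))"
  shows "bounded_derivs V n (\<lambda>m. F m $ i)"
proof (rule bounded_derivs_iterate)
  fix as :: "(real ^ 'd) list" assume "length as \<le> n"
  from bounded_range_component[OF assms[OF this], of i]
  show "bounded (range (foldr (\<lambda>a h m. V a m h) as (\<lambda>m. F m $ i)))"
    by (simp add: iter_deriv_component)
qed

section \<open>Isometric frames\<close>

locale isometric_system =
  fixes \<A> :: "('m::{t2_space, second_countable_topology}, 'd::finite) chart set"
    and g :: "'m \<Rightarrow> 'm tvec \<Rightarrow> 'm tvec \<Rightarrow> real"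
    and nabla :: "'m \<Rightarrow> 'm tvec \<Rightarrow> 'm vfield \<Rightarrow> 'm tvec"
    and V :: "real ^ 'd \<Rightarrow> 'm vfield"
    and Q :: "real ^ 'd \<Rightarrow> real ^ 'd \<Rightarrow> 'm \<Rightarrow> real ^ 'd"
  assumes atlas: "smooth_atlas \<A>"
    and metric: "riemannian_metric \<A> g"
    and parallel: "parallelizable \<A>"
    and connection: "levi_civita \<A> g nabla"
    and system: "dynamical_system \<A> V"
    and isometric: "g m (V a m) (V b m) = a \<bullet> b"
    and smooth_Q: "smooth_map \<A> (Q a b)"
    and bracket_V: "lie_bracket (V a) (V b) = fun_field V (Q a b)"
begin

lemma V_field: "V a \<in> vector_fields \<A>"
  using system by (simp add: dynamical_system_def)

lemma V_tangent: "V a m \<in> tangent_space \<A> m"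
  by (rule vector_field_tangent[OF V_field])

lemma V_linear: "linear (\<lambda>a. V a m f)"
  using system by (intro linearI) (simp_all add: dynamical_system_def)

lemma V_add: "V (a + b) m = (\<lambda>f. V a m f + V b m f)"
  using system by (simp add: dynamical_system_def)

lemma V_scale: "V (c *\<^sub>R a) m = (\<lambda>f. c * V a m f)"
  using system by (simp add: dynamical_system_def)

lemma V_zero: "V 0 m = (\<lambda>f. 0)"
  using V_scale[of 0 0 m] by simp

lemma V_sum: "V (\<Sum>i\<in>I. c i *\<^sub>R b i) m f = (\<Sum>i\<in>I. c i * V (b i) m f)"
  by (simp add: linear_sum[OF V_linear] linear_scale[OF V_linear])

lemma V_expand: "V a m f = (\<Sum>i\<in>UNIV. a $ i * V (axis i 1) m f)"
  using V_sum[of "\<lambda>i. a $ i" "\<lambda>i. axis i 1" UNIV m f] basis_expansion[of a]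
  by (simp add: scalar_mult_eq_scaleR)

lemma gnorm_V: "gnorm g m (V a m) = norm a"
  by (simp add: gnorm_def isometric norm_eq_sqrt_inner)

lemma V_eq_iff: "V a m = V b m \<longleftrightarrow> a = b"
proof
  assume eq: "V a m = V b m"
  have "V (a - b) m = (\<lambda>f. 0)"
    using eq by (simp add: linear_diff[OF V_linear] fun_eq_iff)
  then have "norm (a - b) = norm (0 :: real ^ 'd)"
    using gnorm_V[of m "a - b"] gnorm_V[of m 0] by (simp add: V_zero)
  then show "a = b" by simp
qed simp

text \<open>The coordinates of \<open>V a m\<close> with respect to a parallelizing frame depend linearly and, as \<open>V\<close>
  is isometric, injectively on \<open>a\<close>. An injective endomorphism of a finite-dimensional space is
  surjective, so every tangent vector at \<open>m\<close> is some \<open>V a m\<close>.\<close>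

lemma tangent_space_eq: "tangent_space \<A> m = range (\<lambda>a. V a m)"
proof
  show "range (\<lambda>a. V a m) \<subseteq> tangent_space \<A> m"
    using V_tangent by blast
  obtain E :: "'d \<Rightarrow> 'm vfield" where
    "\<forall>m. \<forall>v\<in>tangent_space \<A> m. \<exists>!c :: real ^ 'd. v = (\<lambda>f. \<Sum>i\<in>UNIV. c $ i * E i m f)"
    using parallel unfolding parallelizable_def by (elim exE conjE) (rule that)
  then have E: "\<exists>!c :: real ^ 'd. v = (\<lambda>f. \<Sum>i\<in>UNIV. c $ i * E i m f)"
    if "v \<in> tangent_space \<A> m" for v
    using that by blast
  define c where "c a = (THE c :: real ^ 'd. V a m = (\<lambda>f. \<Sum>i\<in>UNIV. c $ i * E i m f))" for a
  have c: "V a m = (\<lambda>f. \<Sum>i\<in>UNIV. c a $ i * E i m f)" for a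
    unfolding c_def by (rule theI'[OF E[OF V_tangent]])
  have c_unique: "c a = x" if "V a m = (\<lambda>f. \<Sum>i\<in>UNIV. x $ i * E i m f)" for a x
    unfolding c_def by (rule the1_equality[OF E[OF V_tangent] that])
  have "linear c"
  proof (rule linearI)
    show "c (a + b) = c a + c b" for a b
      by (rule c_unique) (simp only: V_add c[of a] c[of b] sum.distrib distrib_right vector_add_component)
    show "c (r *\<^sub>R a) = r *\<^sub>R c a" for r a
      by (rule c_unique) (simp only: V_scale c[of a] sum_distrib_left mult.assoc
          vector_scaleR_component real_scaleR_def)
  qed
  moreover have "inj c"
  proof (rule injI)
    fix a b assume "c a = c b"
    then have "V a m = V b m" by (simp only: c[of a] c[of b])
    then show "a = b" by (simp add: V_eq_iff)
  qed
  ultimately have "surj c"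
    using linear_injective_imp_surjective by blast
  show "tangent_space \<A> m \<subseteq> range (\<lambda>a. V a m)"
  proof
    fix v assume "v \<in> tangent_space \<A> m"
    then obtain x where "v = (\<lambda>f. \<Sum>i\<in>UNIV. x $ i * E i m f)"
      using ex1_implies_ex[OF E] by blast
    moreover obtain a where "x = c a"
      using \<open>surj c\<close> by (rule surjE)
    ultimately have "v = V a m"
      by (simp only: c[of a])
    then show "v \<in> range (\<lambda>a. V a m)"
      by blast
  qed
qed

lemma tangent_vectorE:
  assumes "v \<in> tangent_space \<A> m"
  obtains a where "v = V a m"
  using assms by (auto simp: tangent_space_eq)

lemma gnorm_add_le:
  assumes "u \<in> tangent_space \<A> m" "v \<in> tangent_space \<A> m"
  shows "gnorm g m (\<lambda>f. u f + v f) \<le> gnorm g m u + gnorm g m v"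
proof -
  obtain a b where "u = V a m" "v = V b m" using assms tangent_vectorE by metis
  then show ?thesis
    using gnorm_V[of m "a + b"] norm_triangle_ineq[of a b] by (simp add: V_add gnorm_V)
qed

lemma gnorm_scale:
  assumes "u \<in> tangent_space \<A> m"
  shows "gnorm g m (\<lambda>f. c * u f) = \<bar>c\<bar> * gnorm g m u"
proof -
  obtain a where "u = V a m" using assms tangent_vectorE by metis
  then show ?thesis
    using gnorm_V[of m "c *\<^sub>R a"] by (simp add: V_scale gnorm_V)
qed

lemma frame_combination_field:
  assumes "\<And>i. smooth_map \<A> (h i)"
  shows "(\<lambda>m f. \<Sum>i\<in>I. h i m * V (b i) m f) \<in> vector_fields \<A>"
proof -
  have "(\<lambda>f. \<Sum>i\<in>I. h i m * V (b i) m f) = V (\<Sum>i\<in>I. h i m *\<^sub>R b i) m" for m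
    by (simp add: V_sum fun_eq_iff)
  then have "(\<lambda>f. \<Sum>i\<in>I. h i m * V (b i) m f) \<in> tangent_space \<A> m" for m
    using V_tangent by simp
  moreover have "smooth_map \<A> (\<lambda>m. \<Sum>i\<in>I. h i m * V (b i) m f)" for f
  proof (cases "finite I")
    case True
    then show ?thesis
      using assms smooth_map_vector_field[OF V_field]
      by (intro smooth_map_sum[OF atlas] smooth_map_mult[OF atlas]) auto
  qed (simp add: smooth_map_const)
  ultimately show ?thesis
    by (simp add: vector_fields_def)
qed

lemma fun_field_expand: "fun_field V F = (\<lambda>m f. \<Sum>i\<in>UNIV. F m $ i * V (axis i 1) m f)"
  by (intro ext) (simp add: fun_field_def V_expand[of "F _"])

text \<open>The coefficient field of \<open>[V\<^sub>a, V\<^sub>F]\<close>: expand \<open>F\<close> in the standard basis and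
  use the Leibniz rule.\<close>

definition bracket_coeff :: "real ^ 'd \<Rightarrow> ('m \<Rightarrow> real ^ 'd) \<Rightarrow> 'm \<Rightarrow> real ^ 'd" where
  "bracket_coeff a F m =
     (\<Sum>i\<in>UNIV. F m $ i *\<^sub>R Q a (axis i 1) m) + (\<chi> k. V a m (\<lambda>p. F p $ k))"

lemma lie_bracket_fun_field:
  assumes F: "\<And>i. smooth_map \<A> (\<lambda>m. F m $ i)"
  shows "lie_bracket (V a) (fun_field V F) = fun_field V (bracket_coeff a F)"
proof (intro ext)
  fix m f
  let ?e = "\<lambda>i. axis i 1 :: real ^ 'd"
  have sm: "smooth_map \<A> (\<lambda>p. V (?e i) p f)" for i
    by (rule smooth_map_vector_field[OF V_field])
  have *: "V a m (\<lambda>p. \<Sum>i\<in>UNIV. F p $ i * V (?e i) p f) =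
      (\<Sum>i\<in>UNIV. F m $ i * V a m (\<lambda>p. V (?e i) p f) + V a m (\<lambda>p. F p $ i) * V (?e i) m f)"
    using F sm by (simp add: tangent_vector_sum[OF atlas V_tangent] smooth_map_mult[OF atlas]
        tangent_vector_mult[OF atlas V_tangent])
  have Q: "V (Q a (?e i) m) m f = V a m (\<lambda>p. V (?e i) p f) - V (?e i) m (\<lambda>p. V a p f)" for i
    using bracket_V[of a "?e i"] by (simp add: lie_bracket_def fun_field_def fun_eq_iff)
  have "lie_bracket (V a) (fun_field V F) m f =
      (\<Sum>i\<in>UNIV. F m $ i * V (Q a (?e i) m) m f) + (\<Sum>i\<in>UNIV. V a m (\<lambda>p. F p $ i) * V (?e i) m f)"
    by (simp add: lie_bracket_def fun_field_expand * Q algebra_simps sum.distrib sum_subtractf)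
  also have "\<dots> = fun_field V (bracket_coeff a F) m f"
    by (simp add: fun_field_def bracket_coeff_def V_add V_sum
        V_expand[of "vec_lambda _"])
  finally show "lie_bracket (V a) (fun_field V F) m f = fun_field V (bracket_coeff a F) m f" .
qed

lemma bounded_derivs_const: "bounded_derivs V n (\<lambda>m. c)"
  by (induction n arbitrary: c) (simp_all add: tangent_vector_const[OF atlas V_tangent])

lemma bounded_derivs_add:
  assumes "smooth_map \<A> f" "smooth_map \<A> h" "bounded_derivs V n f" "bounded_derivs V n h"
  shows "bounded_derivs V n (\<lambda>m. f m + h m)"
  using assms
  by (induction n arbitrary: f h)
    (simp_all add: bounded_plus_comp tangent_vector_add[OF atlas V_tangent]
      smooth_map_vector_field[OF V_field])

lemma bounded_range_mult:
  fixes f h :: "'m \<Rightarrow> real"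
  assumes "bounded (range f)" "bounded (range h)"
  shows "bounded (range (\<lambda>m. f m * h m))"
proof -
  obtain B C where "\<And>m. \<bar>f m\<bar> \<le> B" "\<And>m. \<bar>h m\<bar> \<le> C"
    using assms by (auto simp: bounded_iff)
  then have "\<bar>f m * h m\<bar> \<le> B * C" for m
    by (simp add: abs_mult mult_mono')
  then show ?thesis by (auto simp: bounded_iff)
qed

lemma bounded_derivs_mult:
  assumes "smooth_map \<A> f" "smooth_map \<A> h" "bounded_derivs V n f" "bounded_derivs V n h"
  shows "bounded_derivs V n (\<lambda>m. f m * h m)"
  using assms
proof (induction n arbitrary: f h)
  case 0
  then show ?case by (simp add: bounded_range_mult)
next
  case (Suc n)
  have low: "bounded_derivs V n f" "bounded_derivs V n h"
    using Suc.prems bounded_derivs_SucD by blast+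
  have "bounded_derivs V n (\<lambda>m. f m * V a m h + V a m f * h m)" for a
    using Suc.prems low
    by (intro bounded_derivs_add Suc.IH smooth_map_mult[OF atlas] smooth_map_vector_field[OF V_field])
      auto
  then show ?case
    using Suc.prems by (simp add: tangent_vector_mult[OF atlas V_tangent] bounded_range_mult)
qed

lemma bounded_derivs_sum:
  assumes "finite I" "\<And>i. i \<in> I \<Longrightarrow> smooth_map \<A> (f i)"
    and "\<And>i. i \<in> I \<Longrightarrow> bounded_derivs V n (f i)"
  shows "bounded_derivs V n (\<lambda>m. \<Sum>i\<in>I. f i m)"
  using assms
  by (induction I rule: finite_induct)
    (auto intro!: bounded_derivs_const bounded_derivs_add smooth_map_sum[OF atlas])

text \<open>Each bracket with \<open>V a\<close> differentiates the coefficients once, so after fewer than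
  \<open>\<kappa>\<close> brackets at least one bounded derivative is left for the covariant derivative.\<close>

lemma nested_bracket_coeff:
  assumes Q: "\<And>as a b. length as < \<kappa> \<Longrightarrow> bounded (range (iter_deriv V as (Q a b)))"
    and "length ws < \<kappa>"
  shows "\<exists>F. (\<forall>i. smooth_map \<A> (\<lambda>m. F m $ i)) \<and>
      (\<forall>i. bounded_derivs V (\<kappa> - length ws) (\<lambda>m. F m $ i)) \<and>
      foldr (\<lambda>a X. lie_bracket (V a) X) ws (V w) = fun_field V F"
  using assms(2)
proof (induction ws)
  case Nil
  show ?case
    by (rule exI[of _ "\<lambda>m. w"])
      (auto simp: smooth_map_const bounded_derivs_const fun_field_def)
next
  case (Cons a ws)
  then obtain F where F: "\<And>i. smooth_map \<A> (\<lambda>m. F m $ i)"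
      "\<And>i. bounded_derivs V (\<kappa> - length ws) (\<lambda>m. F m $ i)"
      "foldr (\<lambda>a X. lie_bracket (V a) X) ws (V w) = fun_field V F"
    by auto
  define n where "n = \<kappa> - length (a # ws)"
  have n: "\<kappa> - length ws = Suc n" "n < \<kappa>"
    using Cons.prems by (auto simp: n_def)
  have Qb: "bounded_derivs V n (\<lambda>m. Q a b m $ k)" for b k
    using n Q by (intro bounded_derivs_component) simp
  have Qs: "smooth_map \<A> (\<lambda>m. Q a b m $ k)" for b k
    by (rule smooth_map_component[OF atlas smooth_Q])
  have Fb: "bounded_derivs V n (\<lambda>m. F m $ i)" "bounded_derivs V n (\<lambda>m. V a m (\<lambda>p. F p $ i))" for i
    using F(2)[of i] n bounded_derivs_SucD by auto
  have comp: "(\<lambda>m. bracket_coeff a F m $ k) =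
      (\<lambda>m. (\<Sum>i\<in>UNIV. F m $ i * Q a (axis i 1) m $ k) + V a m (\<lambda>p. F p $ k))" for k
    by (simp add: bracket_coeff_def fun_eq_iff)
  have "smooth_map \<A> (\<lambda>m. bracket_coeff a F m $ k)" for k
    unfolding comp
    by (intro smooth_map_add[OF atlas] smooth_map_sum[OF atlas] smooth_map_mult[OF atlas]
        smooth_map_vector_field[OF V_field] F Qs) simp
  moreover have "bounded_derivs V n (\<lambda>m. bracket_coeff a F m $ k)" for k
    unfolding comp
    by (intro bounded_derivs_add bounded_derivs_sum bounded_derivs_mult Fb Qb Qs F
        smooth_map_sum[OF atlas] smooth_map_mult[OF atlas] smooth_map_vector_field[OF V_field]) simp_all
  moreover have "foldr (\<lambda>a X. lie_bracket (V a) X) (a # ws) (V w) = fun_field V (bracket_coeff a F)"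
    by (simp add: F(3) lie_bracket_fun_field[OF F(1)])
  ultimately show ?case
    unfolding n_def by blast
qed

section \<open>The Levi-Civita connection in an isometric frame\<close>

lemma nabla_tangent:
  "Y \<in> vector_fields \<A> \<Longrightarrow> v \<in> tangent_space \<A> m \<Longrightarrow> nabla m v Y \<in> tangent_space \<A> m"
  using connection by (simp add: levi_civita_def)

lemma nabla_linear_direction:
  assumes "Y \<in> vector_fields \<A>" "u \<in> tangent_space \<A> m" "v \<in> tangent_space \<A> m"
  shows "nabla m (\<lambda>f. b * u f + c * v f) Y = (\<lambda>f. b * nabla m u Y f + c * nabla m v Y f)"
  using connection assms by (simp add: levi_civita_def)

lemma nabla_add:
  assumes "Y \<in> vector_fields \<A>" "Z \<in> vector_fields \<A>" "v \<in> tangent_space \<A> m"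
  shows "nabla m v (\<lambda>p f. Y p f + Z p f) = (\<lambda>f. nabla m v Y f + nabla m v Z f)"
  using connection assms by (simp add: levi_civita_def)

lemma nabla_leibniz:
  assumes "Y \<in> vector_fields \<A>" "smooth_map \<A> h" "v \<in> tangent_space \<A> m"
  shows "nabla m v (\<lambda>p f. h p * Y p f) = (\<lambda>f. v h * Y m f + h m * nabla m v Y f)"
  using connection assms by (simp add: levi_civita_def)

lemma nabla_scale:
  assumes "Y \<in> vector_fields \<A>" "v \<in> tangent_space \<A> m"
  shows "nabla m v (\<lambda>p f. c * Y p f) = (\<lambda>f. c * nabla m v Y f)"
  using nabla_leibniz[OF assms(1) smooth_map_const assms(2)]
  by (simp add: tangent_vector_const[OF atlas assms(2)])

lemma nabla_torsion:
  assumes "X \<in> vector_fields \<A>" "Y \<in> vector_fields \<A>"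
  shows "nabla m (X m) Y f - nabla m (Y m) X f = lie_bracket X Y m f"
proof -
  have "(\<lambda>f. nabla m (X m) Y f - nabla m (Y m) X f) = lie_bracket X Y m"
    using connection assms unfolding levi_civita_def by blast
  then show ?thesis by (rule fun_cong)
qed

lemma nabla_metric:
  assumes "Y \<in> vector_fields \<A>" "Z \<in> vector_fields \<A>" "v \<in> tangent_space \<A> m"
  shows "v (\<lambda>p. g p (Y p) (Z p)) = g m (nabla m v Y) (Z m) + g m (Y m) (nabla m v Z)"
  using connection assms by (simp add: levi_civita_def)

definition christoffel :: "real ^ 'd \<Rightarrow> real ^ 'd \<Rightarrow> 'm \<Rightarrow> real ^ 'd" where
  "christoffel a b m = (THE c. nabla m (V a m) (V b) = V c m)"

lemma nabla_V: "nabla m (V a m) (V b) = V (christoffel a b m) m"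
proof -
  obtain c where c: "nabla m (V a m) (V b) = V c m"
    using nabla_tangent[OF V_field V_tangent] tangent_vectorE by blast
  then show ?thesis by (simp add: christoffel_def V_eq_iff)
qed

lemma christoffel_linear: "linear (\<lambda>a. christoffel a b m)"
proof (rule linearI)
  fix x y :: "real ^ 'd" and c :: real
  show "christoffel (x + y) b m = christoffel x b m + christoffel y b m"
    using nabla_linear_direction[OF V_field V_tangent V_tangent, of m 1 x 1 y b]
    by (simp add: V_add[symmetric] nabla_V V_eq_iff)
  show "christoffel (c *\<^sub>R x) b m = c *\<^sub>R christoffel x b m"
    using nabla_linear_direction[OF V_field V_tangent V_tangent, of m c x 0 x b]
    by (simp add: V_scale[symmetric] nabla_V V_eq_iff)
qed

text \<open>The next two lemmas are the torsion and metric conditions in the frame: torsion gives the part of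
  \<^const>\<open>christoffel\<close> that is antisymmetric in the two arguments, and the constancy of the scalar
  products of the frame fields makes \<open>\<nabla>\<^sub>v\<close> skew-adjoint.\<close>

lemma christoffel_torsion: "christoffel a b m - christoffel b a m = Q a b m"
proof -
  have "V (christoffel a b m - christoffel b a m) m = V (Q a b m) m"
    using nabla_torsion[OF V_field V_field, of m a b]
    by (simp add: nabla_V linear_diff[OF V_linear] bracket_V fun_field_def fun_eq_iff)
  then show ?thesis by (simp add: V_eq_iff)
qed

lemma christoffel_skew: "christoffel a b m \<bullet> c + christoffel a c m \<bullet> b = 0"
  using nabla_metric[of "V b" "V c" "V a m" m, OF V_field V_field V_tangent]
  by (simp add: nabla_V isometric tangent_vector_const[OF atlas V_tangent] inner_commute)

text \<open>The Koszul formula. The scalar products of the frame fields are constant, so only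
  the bracket terms remain.\<close>

lemma christoffel_koszul:
  "2 * (christoffel a b m \<bullet> c) = Q a b m \<bullet> c - Q b c m \<bullet> a + Q c a m \<bullet> b"
  using christoffel_skew[of a b m c] christoffel_skew[of b c m a] christoffel_skew[of c a m b]
  by (simp add: christoffel_torsion[symmetric] inner_diff_left)

lemma bounded_christoffel:
  assumes "\<And>a b. bounded (range (Q a b))"
  shows "bounded (range (christoffel a b))"
proof -
  have "\<exists>B. \<forall>m. \<bar>Q a b m \<bullet> c\<bar> \<le> B" for a b c
  proof -
    obtain B where "\<And>m. norm (Q a b m) \<le> B"
      using assms[of a b] by (auto simp: bounded_iff)
    then have "\<bar>Q a b m \<bullet> c\<bar> \<le> B * norm c" for m
      using Cauchy_Schwarz_ineq2[of "Q a b m" c] mult_right_mono[of _ B "norm c"]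
      by (meson norm_ge_zero order_trans)
    then show ?thesis by blast
  qed
  then obtain B where B: "\<And>a b c m. \<bar>Q a b m \<bullet> c\<bar> \<le> B a b c"
    by metis
  let ?B = "\<lambda>k. B a b (axis k 1) + B b (axis k 1) a + B (axis k 1) a b"
  have "norm (christoffel a b m) \<le> (\<Sum>k\<in>UNIV. ?B k)" for m
  proof -
    have "\<bar>christoffel a b m $ k\<bar> \<le> ?B k" for k
      using christoffel_koszul[of a b m "axis k 1"] B[of a b m "axis k 1"] B[of b "axis k 1" m a]
        B[of "axis k 1" a m b] by (simp add: inner_axis)
    then show ?thesis
      by (intro order_trans[OF norm_le_l1_cart] sum_mono) simp
  qed
  then show ?thesis by (auto simp: bounded_iff)
qed

lemma nabla_frame_combination:
  assumes v: "v \<in> tangent_space \<A> m" and h: "\<And>i. smooth_map \<A> (h i)" and "finite I"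
  shows "nabla m v (\<lambda>p f. \<Sum>i\<in>I. h i p * V (b i) p f) =
    (\<lambda>f. \<Sum>i\<in>I. v (h i) * V (b i) m f + h i m * nabla m v (V (b i)) f)"
  using assms(3)
proof (induction I rule: finite_induct)
  case empty
  then show ?case using nabla_scale[OF V_field v, of 0] by simp
next
  case (insert i I)
  have field: "(\<lambda>p f. h i p * V (b i) p f) \<in> vector_fields \<A>"
    using frame_combination_field[where h = h and b = b and I = "{i}", OF h] by simp
  show ?case
    using insert nabla_add[OF field frame_combination_field[where h = h and b = b and I = I, OF h] v]
    by (simp add: nabla_leibniz[OF V_field h v])
qed

text \<open>A bound over all directions follows from bounds in the coordinate directions, because
  the unit vector \<open>u\<close> enters linearly and has coordinates of absolute value at most 1.\<close>

lemma bounded_unit_directions: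
  fixes L :: "real ^ 'd \<Rightarrow> 'm \<Rightarrow> 'b::real_normed_vector"
  assumes "\<And>m. linear (\<lambda>u. L u m)" "\<And>u. bounded (range (L u))"
  shows "\<exists>B. \<forall>u m. norm u = 1 \<longrightarrow> norm (L u m) \<le> B"
proof -
  obtain B where B: "\<And>u m. norm (L u m) \<le> B u"
    using assms(2) unfolding bounded_iff by (metis rangeI)
  have "norm (L u m) \<le> (\<Sum>i\<in>UNIV. B (axis i 1))" if "norm u = 1" for u m
  proof -
    have "L u m = L (\<Sum>i\<in>UNIV. u $ i *\<^sub>R axis i 1) m"
      using basis_expansion[of u] by (simp add: scalar_mult_eq_scaleR)
    also have "\<dots> = (\<Sum>i\<in>UNIV. u $ i *\<^sub>R L (axis i 1) m)"
      by (simp add: linear_sum[OF assms(1)] linear_scale[OF assms(1)])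
    also have "norm \<dots> \<le> (\<Sum>i\<in>UNIV. B (axis i 1))"
    proof (intro sum_norm_le)
      fix i
      have "\<bar>u $ i\<bar> \<le> 1" using component_le_norm_cart[of u i] that by simp
      then have "\<bar>u $ i\<bar> * norm (L (axis i 1) m) \<le> 1 * norm (L (axis i 1) m)"
        by (rule mult_right_mono) simp
      then show "norm (u $ i *\<^sub>R L (axis i 1) m) \<le> B (axis i 1)"
        using B[of "axis i 1" m] by simp
    qed
    finally show ?thesis .
  qed
  then show ?thesis by blast
qed

lemma bounded_nabla_fun_field:
  assumes Q: "\<And>a b. bounded (range (Q a b))"
    and F: "\<And>i. smooth_map \<A> (\<lambda>m. F m $ i)" "\<And>i. bounded_derivs V 1 (\<lambda>m. F m $ i)"
  shows "\<exists>B. \<forall>m. \<forall>v\<in>tangent_space \<A> m. gnorm g m v = 1 \<longrightarrow>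
    gnorm g m (nabla m v (fun_field V F)) \<le> B"
proof -
  let ?e = "\<lambda>i. axis i 1 :: real ^ 'd"
  \<comment> \<open>the coefficient of \<open>\<nabla>V\<^sub>F\<close> at \<open>m\<close> in the direction \<open>V u m\<close>\<close>
  define L where "L u m = (\<Sum>i\<in>UNIV. V u m (\<lambda>p. F p $ i) *\<^sub>R ?e i + F m $ i *\<^sub>R christoffel u (?e i) m)"
    for u m
  have nabla_L: "nabla m (V u m) (fun_field V F) = V (L u m) m" for u m
    by (simp add: fun_field_expand nabla_frame_combination[OF V_tangent F(1)] nabla_V L_def
        linear_sum[OF V_linear] V_add V_scale fun_eq_iff)
  have "linear (\<lambda>u. L u m)" for m
    unfolding L_def
    by (intro linearI)
      (simp_all add: V_add V_scale linear_add[OF christoffel_linear]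
        linear_scale[OF christoffel_linear] sum.distrib algebra_simps scaleR_sum_right)
  moreover have "bounded (range (L u))" for u
  proof -
    obtain B C D where B: "\<And>i m. \<bar>V u m (\<lambda>p. F p $ i)\<bar> \<le> B i" and C: "\<And>i m. \<bar>F m $ i\<bar> \<le> C i"
      and D: "\<And>i m. norm (christoffel u (?e i) m) \<le> D i"
    proof -
      have "\<forall>i. bounded (range (\<lambda>m. V u m (\<lambda>p. F p $ i)))" "\<forall>i. bounded (range (\<lambda>m. F m $ i))"
        using F(2) by auto
      moreover have "\<forall>i. bounded (range (christoffel u (?e i)))"
        using bounded_christoffel[OF Q] by blast
      ultimately show ?thesis
        using that unfolding bounded_iff by (metis rangeI real_norm_def)
    qed
    have "norm (L u m) \<le> (\<Sum>i\<in>UNIV. B i + C i * D i)" for m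
      unfolding L_def
    proof (intro sum_norm_le)
      fix i
      have "\<bar>F m $ i\<bar> * norm (christoffel u (?e i) m) \<le> C i * D i"
        using C[of m i] D[of i m] by (simp add: mult_mono')
      then show "norm (V u m (\<lambda>p. F p $ i) *\<^sub>R ?e i + F m $ i *\<^sub>R christoffel u (?e i) m) \<le> B i + C i * D i"
        using B[of m i] by (intro norm_triangle_le) (simp add: norm_axis_1 add_mono)
    qed
    then show ?thesis by (auto simp: bounded_iff)
  qed
  ultimately obtain B where "\<And>u m. norm u = 1 \<Longrightarrow> norm (L u m) \<le> B"
    using bounded_unit_directions[of L] by blast
  then show ?thesis
    by (intro exI[of _ B]) (auto simp: tangent_space_eq gnorm_V nabla_L)
qed

lemma bounded_fun_field:
  assumes "\<And>i. bounded_derivs V n (\<lambda>m. F m $ i)"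
  shows "\<exists>B. \<forall>m. gnorm g m (fun_field V F m) \<le> B"
proof -
  have "\<forall>i. bounded_derivs V 0 (\<lambda>m. F m $ i)"
    using assms bounded_derivs_mono by blast
  then obtain B where B: "\<And>i m. \<bar>F m $ i\<bar> \<le> B i"
    unfolding bounded_iff bounded_derivs.simps by (metis rangeI real_norm_def)
  have "norm (F m) \<le> (\<Sum>i\<in>UNIV. B i)" for m
    using B by (intro order_trans[OF norm_le_l1_cart] sum_mono)
  then show ?thesis by (auto simp: fun_field_def gnorm_V)
qed

end

section \<open>Right-nested brackets in the truncated tensor algebra\<close>

text \<open>Both sides are the sum over all ways to cut \<open>w\<close> into three pieces. Truncation does not interfere,
  because every piece of a word of length at most \<open>\<kappa>\<close> has length at most \<open>\<kappa>\<close>.\<close>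

lemma tmult_assoc: "tmult \<kappa> (tmult \<kappa> R S) T = tmult \<kappa> R (tmult \<kappa> S T)"
proof
  fix w :: "'a list"
  let ?n = "length w"
  let ?t = "\<lambda>i j. R (take j w) * S (take (i - j) (drop j w)) * T (drop i w)"
  show "tmult \<kappa> (tmult \<kappa> R S) T w = tmult \<kappa> R (tmult \<kappa> S T) w"
  proof (cases "?n \<le> \<kappa>")
    case True
    have "tmult \<kappa> (tmult \<kappa> R S) T w = (\<Sum>i\<le>?n. \<Sum>j\<le>i. ?t i j)"
      using True
      by (auto simp: tmult_def sum_distrib_right drop_take min_def intro!: sum.cong)
    also have "\<dots> = (\<Sum>j\<le>?n. \<Sum>i\<in>{j..?n}. ?t i j)"
      unfolding sum.Sigma[OF finite_atMost ballI[OF finite_atMost]]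
        sum.Sigma[OF finite_atMost ballI[OF finite_atLeastAtMost]]
      by (rule sum.reindex_bij_witness[of _ prod.swap prod.swap]) auto
    also have "\<dots> = (\<Sum>j\<le>?n. \<Sum>k\<le>?n - j. ?t (j + k) j)"
    proof (rule sum.cong[OF refl])
      fix j assume "j \<in> {..?n}"
      then show "(\<Sum>i\<in>{j..?n}. ?t i j) = (\<Sum>k\<le>?n - j. ?t (j + k) j)"
        by (intro sum.reindex_bij_witness[of _ "\<lambda>k. j + k" "\<lambda>i. i - j"]) auto
    qed
    also have "\<dots> = tmult \<kappa> R (tmult \<kappa> S T) w"
      using True by (auto simp: tmult_def sum_distrib_left mult.assoc add.commute intro!: sum.cong)
    finally show ?thesis .
  qed (simp add: tmult_def)
qed

lemma tmult_add_left: "tmult \<kappa> (\<lambda>w. S w + T w) R = (\<lambda>w. tmult \<kappa> S R w + tmult \<kappa> T R w)"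
  by (auto simp: tmult_def fun_eq_iff distrib_right sum.distrib)

lemma tmult_add_right: "tmult \<kappa> R (\<lambda>w. S w + T w) = (\<lambda>w. tmult \<kappa> R S w + tmult \<kappa> R T w)"
  by (auto simp: tmult_def fun_eq_iff distrib_left sum.distrib)

lemma tmult_scale_left: "tmult \<kappa> (\<lambda>w. c * T w) R = (\<lambda>w. c * tmult \<kappa> T R w)"
  by (auto simp: tmult_def fun_eq_iff sum_distrib_left mult.assoc)

lemma tmult_scale_right: "tmult \<kappa> R (\<lambda>w. c * T w) = (\<lambda>w. c * tmult \<kappa> R T w)"
  by (auto simp: tmult_def fun_eq_iff sum_distrib_left mult.left_commute)

lemma tmult_diff_left: "tmult \<kappa> (\<lambda>w. S w - T w) R = (\<lambda>w. tmult \<kappa> S R w - tmult \<kappa> T R w)"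
  by (auto simp: tmult_def fun_eq_iff left_diff_distrib sum_subtractf)

lemma tmult_diff_right: "tmult \<kappa> R (\<lambda>w. S w - T w) = (\<lambda>w. tmult \<kappa> R S w - tmult \<kappa> R T w)"
  by (auto simp: tmult_def fun_eq_iff right_diff_distrib sum_subtractf)

text \<open>The Jacobi identity, written as a sum with the factor \<open>-1\<close> so that closure under addition and
  scaling applies to the right-hand side.\<close>

lemma tbracket_jacobi:
  "tbracket \<kappa> (tbracket \<kappa> R S) T =
    (\<lambda>w. tbracket \<kappa> R (tbracket \<kappa> S T) w + (-1) * tbracket \<kappa> S (tbracket \<kappa> R T) w)"
  by (simp add: tbracket_def tmult_diff_left tmult_diff_right tmult_assoc fun_eq_iff)

abbreviation nested_bracket :: "nat \<Rightarrow> (real ^ 'd) list \<Rightarrow> real ^ 'd \<Rightarrow> 'd tensor" where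
  "nested_bracket \<kappa> ws w \<equiv> foldr (\<lambda>a T. tbracket \<kappa> (tvector \<kappa> a) T) ws (tvector \<kappa> w)"

inductive_set nested_span :: "nat \<Rightarrow> 'd::finite tensor set" for \<kappa> :: nat where
  nested: "nested_bracket \<kappa> ws w \<in> nested_span \<kappa>"
| add: "S \<in> nested_span \<kappa> \<Longrightarrow> T \<in> nested_span \<kappa> \<Longrightarrow> (\<lambda>w. S w + T w) \<in> nested_span \<kappa>"
| scale: "T \<in> nested_span \<kappa> \<Longrightarrow> (\<lambda>w. c * T w) \<in> nested_span \<kappa>"

lemma tbracket_tvector_nested_span:
  assumes "T \<in> nested_span \<kappa>"
  shows "tbracket \<kappa> (tvector \<kappa> a) T \<in> nested_span \<kappa>"
  using assms
proof induction
  case (nested ws w)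
  show ?case using nested_span.nested[of \<kappa> "a # ws" w] by simp
next
  case (add S T)
  have "tbracket \<kappa> (tvector \<kappa> a) (\<lambda>w. S w + T w) =
      (\<lambda>w. tbracket \<kappa> (tvector \<kappa> a) S w + tbracket \<kappa> (tvector \<kappa> a) T w)"
    by (simp add: tbracket_def tmult_add_left tmult_add_right fun_eq_iff)
  then show ?case using nested_span.add[OF add.IH] by simp
next
  case (scale T c)
  have "tbracket \<kappa> (tvector \<kappa> a) (\<lambda>w. c * T w) = (\<lambda>w. c * tbracket \<kappa> (tvector \<kappa> a) T w)"
    by (simp add: tbracket_def tmult_scale_left tmult_scale_right right_diff_distrib fun_eq_iff)
  then show ?case using nested_span.scale[OF scale.IH] by simp
qed

text \<open>By the Jacobi identity, bracketing with \<open>[a, S]\<close> reduces to bracketing with \<open>a\<close> and with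
  the shorter nested bracket \<open>S\<close>.\<close>

lemma tbracket_nested_span:
  assumes "S \<in> nested_span \<kappa>" "T \<in> nested_span \<kappa>"
  shows "tbracket \<kappa> S T \<in> nested_span \<kappa>"
  using assms
proof (induction arbitrary: T)
  case (nested ws w)
  then show ?case
  proof (induction ws arbitrary: T)
    case Nil
    then show ?case by (simp add: tbracket_tvector_nested_span)
  next
    case (Cons a ws)
    show ?case
      unfolding foldr.simps o_apply tbracket_jacobi
      by (intro nested_span.add nested_span.scale tbracket_tvector_nested_span Cons)
  qed
next
  case (add R S)
  have "tbracket \<kappa> (\<lambda>w. R w + S w) T = (\<lambda>w. tbracket \<kappa> R T w + tbracket \<kappa> S T w)"
    by (simp add: tbracket_def tmult_add_left tmult_add_right fun_eq_iff)
  then show ?case using nested_span.add[OF add.IH] add.prems by simp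
next
  case (scale S c)
  have "tbracket \<kappa> (\<lambda>w. c * S w) T = (\<lambda>w. c * tbracket \<kappa> S T w)"
    by (simp add: tbracket_def tmult_scale_left tmult_scale_right right_diff_distrib fun_eq_iff)
  then show ?case using nested_span.scale[OF scale.IH] scale.prems by simp
qed

lemma free_nilpotent_nested_span:
  assumes "T \<in> free_nilpotent \<kappa>"
  shows "T \<in> nested_span \<kappa>"
  using assms
proof induction
  case (vector a)
  show ?case using nested_span.nested[of \<kappa> "[]" a] by simp
qed (auto intro: nested_span.intros tbracket_nested_span)

lemma nested_bracket_free_nilpotent: "nested_bracket \<kappa> ws w \<in> free_nilpotent \<kappa>"
  by (induction ws) (auto intro: free_nilpotent.intros)

lemma nested_span_free_nilpotent:
  "T \<in> nested_span \<kappa> \<Longrightarrow> T \<in> free_nilpotent \<kappa>"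
  by (induction rule: nested_span.induct)
    (auto intro: free_nilpotent.add free_nilpotent.scale nested_bracket_free_nilpotent)

lemma free_nilpotent_support:
  assumes "T \<in> free_nilpotent \<kappa>" "\<kappa> < length w"
  shows "T w = 0"
  using assms
  by (induction) (auto simp: tvector_def tbracket_def tmult_def split: list.splits)

lemma free_nilpotent_Nil: "T \<in> free_nilpotent \<kappa> \<Longrightarrow> T [] = 0"
  by (induction rule: free_nilpotent.induct) (auto simp: tvector_def tbracket_def tmult_def)

text \<open>A bracket of \<open>length ws + 1\<close> vectors has no terms of lower degree, as each factor has degree 1.
  Truncation removes the higher degrees, so the bracket is 0 once it has more than \<open>\<kappa>\<close> factors.\<close>

lemma nested_bracket_below_degree:
  "length v \<le> length ws \<Longrightarrow> nested_bracket \<kappa> ws w v = 0"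
proof (induction ws arbitrary: v)
  case Nil
  then show ?case by (simp add: tvector_def)
next
  case (Cons a ws)
  let ?N = "nested_bracket \<kappa> ws w"
  have N: "tvector \<kappa> a (take i v) * ?N (drop i v) = 0" "?N (take i v) * tvector \<kappa> a (drop i v) = 0"
    for i
  proof -
    show "tvector \<kappa> a (take i v) * ?N (drop i v) = 0"
    proof (cases "i = 0 \<or> v = []")
      case False
      then have "?N (drop i v) = 0" using Cons by (intro Cons.IH) (cases v; auto)
      then show ?thesis by simp
    qed (auto simp: tvector_def)
    show "?N (take i v) * tvector \<kappa> a (drop i v) = 0"
    proof (cases "i \<ge> length v")
      case False
      then have "?N (take i v) = 0" using Cons by (intro Cons.IH) auto
      then show ?thesis by simp
    qed (auto simp: tvector_def)
  qed
  show ?case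
    unfolding foldr.simps o_apply tbracket_def[of _ _ ?N] tmult_def N by simp
qed

lemma nested_bracket_vanish:
  assumes "\<kappa> \<le> length ws"
  shows "nested_bracket \<kappa> ws w = (\<lambda>v. 0)"
proof
  fix v :: "'a list"
  show "nested_bracket \<kappa> ws w v = 0"
    using nested_bracket_below_degree[of v ws \<kappa> w] assms
      free_nilpotent_support[OF nested_bracket_free_nilpotent, of \<kappa> v ws w]
    by (cases "length v \<le> length ws") auto
qed

section \<open>Uniform boundedness in finite dimension\<close>

text \<open>A finite-dimensional uniform boundedness principle for seminorms, by induction on the support \<open>W\<close>:
  if some \<open>f0\<close> in the space has \<open>f0 x = 1\<close>, then \<open>f - f x * f0\<close> lies in the subspace of the
  functions that vanish at \<open>x\<close>.\<close>

lemma uniform_boundedness_finite_support: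
  fixes p :: "'i \<Rightarrow> ('w \<Rightarrow> real) \<Rightarrow> real"
  assumes "finite W"
    and "\<And>f w. f \<in> S \<Longrightarrow> w \<notin> W \<Longrightarrow> f w = 0"
    and "\<And>f h. f \<in> S \<Longrightarrow> h \<in> S \<Longrightarrow> (\<lambda>w. f w + h w) \<in> S"
    and "\<And>f c. f \<in> S \<Longrightarrow> (\<lambda>w. c * f w) \<in> S"
    and "\<And>i f h. i \<in> I \<Longrightarrow> f \<in> S \<Longrightarrow> h \<in> S \<Longrightarrow> p i (\<lambda>w. f w + h w) \<le> p i f + p i h"
    and "\<And>i f c. i \<in> I \<Longrightarrow> f \<in> S \<Longrightarrow> p i (\<lambda>w. c * f w) = \<bar>c\<bar> * p i f"
    and "\<And>f. f \<in> S \<Longrightarrow> \<exists>B. \<forall>i\<in>I. p i f \<le> B"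
  shows "\<exists>C\<ge>0. \<forall>f\<in>S. \<forall>i\<in>I. p i f \<le> C * (\<Sum>w\<in>W. \<bar>f w\<bar>)"
  using assms
proof (induction W arbitrary: S rule: finite_induct)
  case empty
  have "p i f \<le> 0" if "f \<in> S" "i \<in> I" for f i
  proof -
    have "f = (\<lambda>w. 0 * f w)" using empty.prems(1)[OF that(1)] by auto
    then have "p i f = \<bar>0\<bar> * p i f" using empty.prems(5)[OF that(2,1), of 0] by metis
    then show ?thesis by simp
  qed
  then show ?case by (intro exI[of _ 0]) auto
next
  case (insert x W)
  let ?S = "{f \<in> S. f x = 0}"
  have "\<exists>C\<ge>0. \<forall>f\<in>?S. \<forall>i\<in>I. p i f \<le> C * (\<Sum>w\<in>W. \<bar>f w\<bar>)"
    by (rule insert.IH) (use insert.prems in \<open>auto, metis insertE\<close>)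
  then obtain C where C: "C \<ge> 0" "\<And>f i. f \<in> S \<Longrightarrow> f x = 0 \<Longrightarrow> i \<in> I \<Longrightarrow> p i f \<le> C * (\<Sum>w\<in>W. \<bar>f w\<bar>)"
    by auto
  show ?case
  proof (cases "\<exists>f\<in>S. f x \<noteq> 0")
    case False
    then show ?thesis using C insert.hyps by (intro exI[of _ C]) auto
  next
    case True
    then obtain f1 where f1: "f1 \<in> S" "f1 x \<noteq> 0" by blast
    define f0 where "f0 = (\<lambda>w. inverse (f1 x) * f1 w)"
    have f0: "f0 \<in> S" "f0 x = 1"
      using insert.prems(3)[OF f1(1)] f1(2) by (simp_all add: f0_def)
    obtain B where B: "\<And>i. i \<in> I \<Longrightarrow> p i f0 \<le> B"
      using insert.prems(6)[OF f0(1)] by blast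
    define D where "D = C + \<bar>B\<bar> + C * (\<Sum>w\<in>W. \<bar>f0 w\<bar>)"
    have D0: "0 \<le> C * (\<Sum>w\<in>W. \<bar>f0 w\<bar>)"
      using C(1) by (simp add: sum_nonneg)
    have "p i f \<le> D * (\<Sum>w\<in>insert x W. \<bar>f w\<bar>)" if f: "f \<in> S" and i: "i \<in> I" for f i
    proof -
      define h where "h = (\<lambda>w. f w + (- f x) * f0 w)"
      have h: "h \<in> S" "h x = 0"
        unfolding h_def by (rule insert.prems(2)[OF f insert.prems(3)[OF f0(1)]]) (simp add: f0(2))
      have "p i f = p i (\<lambda>w. f x * f0 w + h w)"
        by (simp add: h_def)
      also have "\<dots> \<le> p i (\<lambda>w. f x * f0 w) + p i h"
        by (rule insert.prems(4)[OF i insert.prems(3)[OF f0(1)] h(1)])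
      also have "p i (\<lambda>w. f x * f0 w) \<le> \<bar>f x\<bar> * \<bar>B\<bar>"
        using insert.prems(5)[OF i f0(1)] B[OF i] by (simp add: mult_left_mono)
      also have "p i h \<le> C * (\<Sum>w\<in>W. \<bar>f w\<bar> + \<bar>f x\<bar> * \<bar>f0 w\<bar>)"
      proof -
        have "(\<Sum>w\<in>W. \<bar>h w\<bar>) \<le> (\<Sum>w\<in>W. \<bar>f w\<bar> + \<bar>f x\<bar> * \<bar>f0 w\<bar>)"
          by (intro sum_mono) (auto simp: h_def abs_mult[symmetric])
        then show ?thesis
          using C(2)[OF h i] C(1) by (meson mult_left_mono order_trans)
      qed
      also have "\<bar>f x\<bar> * \<bar>B\<bar> + C * (\<Sum>w\<in>W. \<bar>f w\<bar> + \<bar>f x\<bar> * \<bar>f0 w\<bar>) =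
          (\<bar>B\<bar> + C * (\<Sum>w\<in>W. \<bar>f0 w\<bar>)) * \<bar>f x\<bar> + C * (\<Sum>w\<in>W. \<bar>f w\<bar>)"
        by (simp add: sum.distrib sum_distrib_left algebra_simps)
      also have "\<dots> \<le> D * \<bar>f x\<bar> + D * (\<Sum>w\<in>W. \<bar>f w\<bar>)"
        using C(1) D0 by (intro add_mono mult_right_mono) (simp_all add: D_def sum_nonneg)
      also have "\<dots> = D * (\<Sum>w\<in>insert x W. \<bar>f w\<bar>)"
        using insert.hyps by (simp add: distrib_left)
      finally show ?thesis by simp
    qed
    moreover have "D \<ge> 0" using C(1) D0 by (simp add: D_def)
    ultimately show ?thesis by blast
  qed
qed

lemma uniform_bound_free_nilpotent:
  fixes p :: "'i \<Rightarrow> 'd::finite tensor \<Rightarrow> real"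
  assumes "\<And>i S T. i \<in> I \<Longrightarrow> S \<in> free_nilpotent \<kappa> \<Longrightarrow> T \<in> free_nilpotent \<kappa> \<Longrightarrow>
      p i (\<lambda>w. S w + T w) \<le> p i S + p i T"
    and "\<And>i T c. i \<in> I \<Longrightarrow> T \<in> free_nilpotent \<kappa> \<Longrightarrow> p i (\<lambda>w. c * T w) = \<bar>c\<bar> * p i T"
    and "\<And>T. T \<in> free_nilpotent \<kappa> \<Longrightarrow> \<exists>B. \<forall>i\<in>I. p i T \<le> B"
  shows "\<exists>C. \<forall>T\<in>free_nilpotent \<kappa>. tnorm \<kappa> T = 1 \<longrightarrow> (\<forall>i\<in>I. p i T \<le> C)"
proof -
  let ?W = "{w :: 'd list. length w \<le> \<kappa>}"
  have W: "finite ?W"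
    using finite_lists_length_le[of "UNIV :: 'd set" \<kappa>] by simp
  have "\<exists>C\<ge>0. \<forall>T\<in>free_nilpotent \<kappa>. \<forall>i\<in>I. p i T \<le> C * (\<Sum>w\<in>?W. \<bar>T w\<bar>)"
    by (rule uniform_boundedness_finite_support[OF W])
      (use assms in \<open>auto intro: free_nilpotent.intros free_nilpotent_support\<close>)
  then obtain C where C: "C \<ge> 0" "\<And>T i. T \<in> free_nilpotent \<kappa> \<Longrightarrow> i \<in> I \<Longrightarrow> p i T \<le> C * (\<Sum>w\<in>?W. \<bar>T w\<bar>)"
    by auto
  have "p i T \<le> C * real (card ?W)" if T: "T \<in> free_nilpotent \<kappa>" "tnorm \<kappa> T = 1" and "i \<in> I" for i T
  proof -
    have "\<bar>T w\<bar> \<le> 1" if "w \<in> ?W" for w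
    proof -
      have "(T w)\<^sup>2 \<le> (\<Sum>w\<in>?W. (T w)\<^sup>2)"
        by (rule member_le_sum[OF that _ W]) simp
      also have "\<dots> = 1" using T(2) by (simp add: tnorm_def)
      finally show ?thesis by (simp add: abs_square_le_1)
    qed
    then have "(\<Sum>w\<in>?W. \<bar>T w\<bar>) \<le> real (card ?W)"
      using sum_bounded_above[of ?W "\<lambda>w. \<bar>T w\<bar>" 1] by simp
    then show ?thesis
      using C(2)[OF T(1) \<open>i \<in> I\<close>] C(1) by (meson mult_left_mono order_trans)
  qed
  then show ?thesis by blast
qed

section \<open>The extension to the free nilpotent Lie algebra\<close>

lemma lie_extensionD:
  assumes "lie_extension \<A> \<kappa> V VK"
  shows lie_extension_field: "T \<in> free_nilpotent \<kappa> \<Longrightarrow> VK T \<in> vector_fields \<A>"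
    and lie_extension_add: "S \<in> free_nilpotent \<kappa> \<Longrightarrow> T \<in> free_nilpotent \<kappa> \<Longrightarrow>
      VK (\<lambda>w. S w + T w) = (\<lambda>m f. VK S m f + VK T m f)"
    and lie_extension_scale: "T \<in> free_nilpotent \<kappa> \<Longrightarrow> VK (\<lambda>w. c * T w) = (\<lambda>m f. c * VK T m f)"
    and lie_extension_nested: "length ws < \<kappa> \<Longrightarrow>
      VK (nested_bracket \<kappa> ws w) = foldr (\<lambda>a X. lie_bracket (V a) X) ws (V w)"
  using assms by (simp_all add: lie_extension_def)

context isometric_system
begin

text \<open>Nested brackets of more than \<open>\<kappa>\<close> vectors, for which the count of derivatives gives no bound,
  are 0 in the truncated algebra and have the coefficient 0.\<close>

lemma lie_extension_coeff:
  assumes ext: "lie_extension \<A> \<kappa> V VK"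
    and Q: "\<And>as a b. length as < \<kappa> \<Longrightarrow> bounded (range (iter_deriv V as (Q a b)))"
    and "T \<in> free_nilpotent \<kappa>"
  shows "\<exists>F. (\<forall>i. smooth_map \<A> (\<lambda>m. F m $ i)) \<and> (\<forall>i. bounded_derivs V 1 (\<lambda>m. F m $ i)) \<and>
    VK T = fun_field V F"
  using free_nilpotent_nested_span[OF assms(3)]
proof induction
  case (nested ws w)
  show ?case
  proof (cases "length ws < \<kappa>")
    case True
    then obtain F where F: "\<And>i. smooth_map \<A> (\<lambda>m. F m $ i)"
        "\<And>i. bounded_derivs V (\<kappa> - length ws) (\<lambda>m. F m $ i)"
        "foldr (\<lambda>a X. lie_bracket (V a) X) ws (V w) = fun_field V F"
      using nested_bracket_coeff[of \<kappa> ws w] Q by blast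
    have "bounded_derivs V 1 (\<lambda>m. F m $ i)" for i
      using True by (intro bounded_derivs_mono[OF F(2)]) simp
    then show ?thesis
      using F(1,3) lie_extension_nested[OF ext True, of w] by (intro exI[of _ F]) simp
  next
    case False
    then have "VK (nested_bracket \<kappa> ws w) = (\<lambda>m f. 0)"
      using lie_extension_scale[OF ext nested_bracket_free_nilpotent, of 0 ws w]
        nested_bracket_vanish[of \<kappa> ws w] by simp
    then show ?thesis
      by (intro exI[of _ "\<lambda>m. 0"])
        (simp add: smooth_map_const bounded_derivs_const fun_field_def V_zero
          del: bounded_derivs.simps One_nat_def)
  qed
next
  case (add S T)
  then obtain F G where FG: "\<And>i. smooth_map \<A> (\<lambda>m. F m $ i)" "\<And>i. bounded_derivs V 1 (\<lambda>m. F m $ i)"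
      "VK S = fun_field V F" "\<And>i. smooth_map \<A> (\<lambda>m. G m $ i)"
      "\<And>i. bounded_derivs V 1 (\<lambda>m. G m $ i)" "VK T = fun_field V G"
    by blast
  have "VK (\<lambda>w. S w + T w) = fun_field V (\<lambda>m. F m + G m)"
    using lie_extension_add[OF ext add.hyps[THEN nested_span_free_nilpotent]] FG(3,6)
    by (simp add: fun_field_def V_add)
  then show ?case using FG
    by (intro exI[of _ "\<lambda>m. F m + G m"]) (simp add: smooth_map_add[OF atlas] bounded_derivs_add
        del: bounded_derivs.simps One_nat_def)
next
  case (scale T c)
  then obtain F where F: "\<And>i. smooth_map \<A> (\<lambda>m. F m $ i)" "\<And>i. bounded_derivs V 1 (\<lambda>m. F m $ i)"
      "VK T = fun_field V F"
    by blast
  have "VK (\<lambda>w. c * T w) = fun_field V (\<lambda>m. c *\<^sub>R F m)"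
    using lie_extension_scale[OF ext scale.hyps[THEN nested_span_free_nilpotent]] F(3)
    by (simp add: fun_field_def V_scale)
  then show ?case using F
    by (intro exI[of _ "\<lambda>m. c *\<^sub>R F m"]) (simp add: smooth_map_mult[OF atlas] smooth_map_const
        bounded_derivs_mult bounded_derivs_const del: bounded_derivs.simps One_nat_def)
qed

end

theorem proposition1p34:
  fixes \<A> :: "('m::{t2_space, second_countable_topology}, 'd::finite) chart set"
    and g :: "'m \<Rightarrow> 'm tvec \<Rightarrow> 'm tvec \<Rightarrow> real"
    and nabla :: "'m \<Rightarrow> 'm tvec \<Rightarrow> 'm vfield \<Rightarrow> 'm tvec"
    and V :: "real ^ 'd \<Rightarrow> 'm vfield"
    and Q :: "real ^ 'd \<Rightarrow> real ^ 'd \<Rightarrow> 'm \<Rightarrow> real ^ 'd"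
    and \<kappa> :: nat
    and VK :: "'d tensor \<Rightarrow> 'm vfield"
  assumes "smooth_atlas \<A>"
    and "riemannian_metric \<A> g"
    and "complete_riemannian \<A> g"
    and "parallelizable \<A>"
    and "levi_civita \<A> g nabla"
    and "dynamical_system \<A> V"
    and "\<forall>a b m. g m (V a m) (V b m) = a \<bullet> b"
    and "\<forall>a b. smooth_map \<A> (Q a b)"
    and "\<forall>a b. lie_bracket (V a) (V b) = fun_field V (Q a b)"
    and "\<forall>as a b. length as < \<kappa> \<longrightarrow> bounded (range (iter_deriv V as (Q a b)))"
    and "lie_extension \<A> \<kappa> V VK"
  shows "field_norm g \<kappa> VK + covariant_norm \<A> g nabla \<kappa> VK < \<infinity>"
proof (cases "\<kappa> = 0")
  \<comment> \<open>here nothing bounds \<open>Q\<close>, but both suprema are over the empty set\<close>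
  case True
  have "tnorm \<kappa> T = 0" if "T \<in> free_nilpotent \<kappa>" for T
    using free_nilpotent_Nil[OF that] True by (simp add: tnorm_def)
  then have none: "{T \<in> free_nilpotent \<kappa>. tnorm \<kappa> T = 1} = {}"
    by force
  show ?thesis
    unfolding field_norm_def covariant_norm_def none by (simp add: bot_ennreal)
next
  case False
  interpret isometric_system \<A> g nabla V Q
    using assms by unfold_locales auto
  note VK_field = lie_extension_field[OF assms(11)]
    and VK_add = lie_extension_add[OF assms(11)]
    and VK_scale = lie_extension_scale[OF assms(11)]
  have Q: "bounded (range (Q a b))" for a b
    using assms(10)[rule_format, of "[]" a b] False by (simp add: iter_deriv_def)
  note coeff = lie_extension_coeff[OF assms(11), OF assms(10)[rule_format]]
  note tangent = vector_field_tangent[OF VK_field]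

  \<comment> \<open>the seminorms are indexed by the points, and below by the points with a unit tangent vector\<close>
  have "\<exists>C. \<forall>T\<in>free_nilpotent \<kappa>. tnorm \<kappa> T = 1 \<longrightarrow> (\<forall>m\<in>UNIV. gnorm g m (VK T m) \<le> C)"
  proof (rule uniform_bound_free_nilpotent)
    fix T :: "'d tensor" assume "T \<in> free_nilpotent \<kappa>"
    then show "\<exists>B. \<forall>m\<in>UNIV. gnorm g m (VK T m) \<le> B"
      using coeff[of T] bounded_fun_field by fastforce
  qed (auto simp: VK_add VK_scale intro: gnorm_add_le gnorm_scale tangent)
  then obtain C where C: "\<And>T m. T \<in> free_nilpotent \<kappa> \<Longrightarrow> tnorm \<kappa> T = 1 \<Longrightarrow> gnorm g m (VK T m) \<le> C"
    by blast

  let ?I = "{(m, v). v \<in> tangent_space \<A> m \<and> gnorm g m v = 1}"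
  let ?p = "\<lambda>(m, v) T. gnorm g m (nabla m v (VK T))"
  have "\<exists>D. \<forall>T\<in>free_nilpotent \<kappa>. tnorm \<kappa> T = 1 \<longrightarrow> (\<forall>i\<in>?I. ?p i T \<le> D)"
  proof (rule uniform_bound_free_nilpotent)
    fix T :: "'d tensor" assume "T \<in> free_nilpotent \<kappa>"
    then show "\<exists>B. \<forall>i\<in>?I. ?p i T \<le> B"
      using coeff[of T] bounded_nabla_fun_field[OF Q] by fastforce
  qed (auto simp: VK_add VK_scale nabla_add nabla_scale VK_field
      intro!: gnorm_add_le gnorm_scale nabla_tangent)
  then obtain D where D: "\<And>T i. T \<in> free_nilpotent \<kappa> \<Longrightarrow> tnorm \<kappa> T = 1 \<Longrightarrow> i \<in> ?I \<Longrightarrow> ?p i T \<le> D"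
    by blast

  have "field_norm g \<kappa> VK \<le> ennreal C"
    unfolding field_norm_def by (intro SUP_least ennreal_leI) (use C in auto)
  moreover have "covariant_norm \<A> g nabla \<kappa> VK \<le> ennreal D"
    unfolding covariant_norm_def by (intro SUP_least) (use D in \<open>fastforce intro: ennreal_leI\<close>)
  ultimately have "field_norm g \<kappa> VK + covariant_norm \<A> g nabla \<kappa> VK \<le> ennreal C + ennreal D"
    by (rule add_mono)
  also have "\<dots> < \<infinity>"
    by (simp add: ennreal_add_eq_top less_top)
  finally show ?thesis .
qed

end
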